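(* Let $A$ be a $C^*$-algebra and let $a=(a_1,\ldots,a_n)$ be an $n$-tuple of regular elements of $A$. Suppose that for all $i,j=1,\ldots,n$ with $i\neq j$, the elements $a_ia_j$, $a_ja_i$, $a_i^*a_j$ and $a_ja_i^*$ are regular and satisfy $$ (a_ia_j)^{\dag}=(a_ja_i)^{\dag},\qquad (a_i^*a_j)^{\dag}=(a_ja_i^* )^{\dag}. $$ Then $a$ is a doubly commuting $n$-tuple of regular elements of $A$.
   Context: An element $x$ of a $C^*$-algebra $A$ is called regular if there exists $y\in A$ with $x=xyx$. Every regular element $x\in A$ has a unique Moore-Penrose inverse $x^{\dag}\in A$, i.e. the unique element satisfying $x=xx^{\dag}x$, $x^{\dag}=x^{\dag}xx^{\dag}$, $(x^{\dag}x)^*=x^{\dag}x$, $(xx^{\dag})^*=xx^{\dag}$. An $n$-tuple $(a_1,\ldots,a_n)$ of elements of $A$ is called doubly commuting if $a_ia_j=a_ja_i$ and $a_ia_j^*=a_j^*a_i$ for all $i,j=1,\ldots,n$ with $i\neq j$. *)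

theory Defs
  imports Complex_Main
begin

text \<open>
  C*-algebras, not assumed unital or nonzero. The superclasses \<^class>\<open>real_normed_algebra\<close> and
  \<^class>\<open>banach\<close> provide the submultiplicative complete norm and the underlying real algebra;
  the complex scalar multiplication extends the real one.
\<close>

class star =
  fixes star :: "'a \<Rightarrow> 'a"  ("(_\<^sup>\<star>)" [1000] 999)

class cstar_algebra = real_normed_algebra + banach + star +
  fixes scaleC :: "complex \<Rightarrow> 'a \<Rightarrow> 'a"  (infixr "*\<^sub>C" 75)
  assumes scaleC_of_real: "complex_of_real r *\<^sub>C x = r *\<^sub>R x"
    and scaleC_add_right: "c *\<^sub>C (x + y) = c *\<^sub>C x + c *\<^sub>C y"
    and scaleC_add_left: "(c + d) *\<^sub>C x = c *\<^sub>C x + d *\<^sub>C x"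
    and scaleC_scaleC: "c *\<^sub>C d *\<^sub>C x = (c * d) *\<^sub>C x"
    and mult_scaleC_left: "(c *\<^sub>C x) * y = c *\<^sub>C (x * y)"
    and mult_scaleC_right: "x * (c *\<^sub>C y) = c *\<^sub>C (x * y)"
    and norm_scaleC: "norm (c *\<^sub>C x) = cmod c * norm x"
    and star_add: "(x + y)\<^sup>\<star> = x\<^sup>\<star> + y\<^sup>\<star>"
    and star_scaleC: "(c *\<^sub>C x)\<^sup>\<star> = cnj c *\<^sub>C x\<^sup>\<star>"
    and star_mult: "(x * y)\<^sup>\<star> = y\<^sup>\<star> * x\<^sup>\<star>"
    and star_star: "(x\<^sup>\<star>)\<^sup>\<star> = x"
    and cstar_identity: "norm (x\<^sup>\<star> * x) = (norm x)\<^sup>2"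

definition regular :: "'a::cstar_algebra \<Rightarrow> bool" where
  "regular x \<longleftrightarrow> (\<exists>y. x = x * y * x)"

definition is_MP_inverse :: "'a::cstar_algebra \<Rightarrow> 'a \<Rightarrow> bool" where
  "is_MP_inverse x y \<longleftrightarrow>
     x = x * y * x \<and> y = y * x * y \<and> (y * x)\<^sup>\<star> = y * x \<and> (x * y)\<^sup>\<star> = x * y"

text \<open>Meaningful only for regular elements, which have exactly one Moore-Penrose inverse.\<close>

definition MP_inverse :: "'a::cstar_algebra \<Rightarrow> 'a"  ("(_\<^sup>\<dagger>)" [1000] 999) where
  "x\<^sup>\<dagger> = (THE y. is_MP_inverse x y)"

text \<open>
  An \<open>n\<close>-tuple is a function on \<^typ>\<open>nat\<close> of which only the values on \<open>{1..n}\<close> matter.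
\<close>

definition doubly_commuting :: "nat \<Rightarrow> (nat \<Rightarrow> 'a::cstar_algebra) \<Rightarrow> bool" where
  "doubly_commuting n a \<longleftrightarrow>
     (\<forall>i\<in>{1..n}. \<forall>j\<in>{1..n}. i \<noteq> j \<longrightarrow>
        a i * a j = a j * a i \<and> a i * (a j)\<^sup>\<star> = (a j)\<^sup>\<star> * a i)"

end

theory Submission
  imports Defs "HOL-Analysis.Elementary_Metric_Spaces"
begin

text \<open>
  A Moore-Penrose inverse determines its element, so equal Moore-Penrose inverses of \<open>xy\<close> and
  \<open>yx\<close> force \<open>xy = yx\<close>; what needs work is the existence of Moore-Penrose inverses of regular
  elements. If \<open>x = xyx\<close>, then \<open>p = xy\<close> is an idempotent, and \<open>e = p(1 + p - p\<^sup>\<star>)\<^sup>-\<^sup>1\<close>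
  is a self-adjoint idempotent with the same range. The inverse exists because \<open>p\<^sup>\<star> - p\<close> is
  skew-adjoint: for skew-adjoint \<open>z\<close> and \<open>(1 - z)(1 + q) = 1\<close> the C*-identity gives
  \<open>\<parallel>q\<parallel> \<le> 1\<close>, an a priori bound which lets one pass from the invertibility of \<open>1 - z\<close> to that
  of \<open>1 - (3/2)z\<close> by a Neumann series. As there need not be a unit, \<open>(1 - z)(1 + q) = 1\<close> is
  written as \<open>q = z + zq\<close>.
\<close>

lemma star_minus: "(- x)\<^sup>\<star> = - (x :: 'a::cstar_algebra)\<^sup>\<star>"
  and star_diff: "(x - y)\<^sup>\<star> = x\<^sup>\<star> - (y :: 'a)\<^sup>\<star>"
proof -
  have "(0 :: 'a)\<^sup>\<star> = 0"
    using star_add[of "0 :: 'a" 0] by simp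
  then show minus: "(- x)\<^sup>\<star> = - x\<^sup>\<star>" for x :: 'a
    using star_add[of x "- x"] by (simp add: eq_neg_iff_add_eq_0 add.commute)
  show "(x - y)\<^sup>\<star> = x\<^sup>\<star> - y\<^sup>\<star>"
    using star_add[of x "- y"] by (simp add: minus)
qed

lemma star_scaleR: "(r *\<^sub>R x)\<^sup>\<star> = r *\<^sub>R (x :: 'a::cstar_algebra)\<^sup>\<star>"
  using star_scaleC[of "complex_of_real r" x] by (simp add: scaleC_of_real)

lemma norm_star: "norm (x\<^sup>\<star>) = norm (x :: 'a::cstar_algebra)"
proof -
  have "norm u \<le> norm (u\<^sup>\<star>)" for u :: 'a
    using norm_mult_ineq[of "u\<^sup>\<star>" u] norm_ge_zero[of "u\<^sup>\<star>"]
    by (cases "u = 0") (simp_all add: cstar_identity power2_eq_square)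
  from this[of x] this[of "x\<^sup>\<star>"] show ?thesis
    by (simp add: star_star)
qed

text \<open>Banach's fixed-point theorem stands in for the Neumann series: the map sending
  \<open>v\<close> to \<open>u + u * v\<close> is a contraction with constant
  \<open>norm u\<close>.\<close>

lemma quasi_inverse_exists_of_norm_less_1:
  fixes u :: "'a::{real_normed_algebra,banach}"
  assumes "norm u < 1"
  shows "\<exists>v. v = u + u * v"
proof -
  have "\<exists>!v. u + u * v = v"
    by (rule banach_fix_type[where c = "norm u"])
       (use assms in \<open>simp_all add: dist_norm norm_mult_ineq flip: right_diff_distrib\<close>)
  then show ?thesis by metis
qed

lemma skew_adjoint_quasi_inverse_bound:
  fixes z q :: "'a::cstar_algebra"
  assumes skew: "z\<^sup>\<star> = - z" and q: "q = z + z * q"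
  shows "norm q \<le> 1"
proof -
  have zq: "z * q = q - z"
    using q by (metis add_diff_cancel_left')
  have sz: "q\<^sup>\<star> * z = - z - q\<^sup>\<star>"
    using arg_cong[OF q, of star] by (simp add: star_add star_mult skew eq_diff_eq add.commute)
  have "q\<^sup>\<star> * (z * q) = (q\<^sup>\<star> * z) * q"
    by (simp only: mult.assoc)
  \<comment> \<open>With a unit adjoined this reads
    \<open>(1 + 2q)\<^sup>\<star> (1 + 2q) = 1\<close>: the Cayley transform
    \<open>1 + 2q = (1 + z)(1 - z)\<^sup>-\<^sup>1\<close> is an isometry.\<close>
  then have "q\<^sup>\<star> * q + q\<^sup>\<star> * q + q\<^sup>\<star> + q = 0"
    by (simp add: zq sz algebra_simps)
  then have "q\<^sup>\<star> * q + q\<^sup>\<star> * q = - q - q\<^sup>\<star>"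
    by (simp add: add_eq_0_iff2 eq_diff_eq)
  then have "2 * norm (q\<^sup>\<star> * q) = norm (- q - q\<^sup>\<star>)"
    by (metis norm_scaleR scaleR_2 abs_numeral)
  also have "\<dots> \<le> 2 * norm q"
    using norm_triangle_ineq4[of "- q" "q\<^sup>\<star>"] by (simp add: norm_star)
  finally show ?thesis
    by (simp add: cstar_identity power2_eq_square)
       (metis mult_le_cancel_right2 norm_ge_zero not_le order.trans zero_le_one)
qed

lemma skew_adjoint_quasi_inverse_exists:
  fixes z :: "'a::cstar_algebra"
  assumes "z\<^sup>\<star> = - z"
  shows "\<exists>q. q = z + z * q"
proof -
  obtain k where "norm z < (3 / 2) ^ k"
    using real_arch_pow[of "3 / 2" "norm z"] by auto
  then show ?thesis
    using assms
  proof (induction k arbitrary: z)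
    case 0
    then show ?case
      by (simp add: quasi_inverse_exists_of_norm_less_1)
  next
    case (Suc k)
    \<comment> \<open>Since \<open>w + w * q = q\<close>, one has
      \<open>(1 - t w)(1 + q) = 1 - (t - 1) q\<close>, invertible for \<open>1 < t < 2\<close>
      because \<open>norm q \<le> 1\<close>; here \<open>t = 3/2\<close>.\<close>
    define w where "w = (2 / 3) *\<^sub>R z"
    have w: "w\<^sup>\<star> = - w" "norm w < (3 / 2) ^ k"
      using Suc.prems by (simp_all add: w_def star_scaleR)
    then obtain q where q: "q = w + w * q"
      using Suc.IH by blast
    have "norm q \<le> 1"
      using skew_adjoint_quasi_inverse_bound[OF w(1) q] .
    then obtain v where v: "v = (1 / 2) *\<^sub>R q + (1 / 2) *\<^sub>R q * v"
      using quasi_inverse_exists_of_norm_less_1[of "(1 / 2) *\<^sub>R q"] by auto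
    have zq: "z * q = (3 / 2) *\<^sub>R q - z"
    proof -
      have "z = (3 / 2) *\<^sub>R w"
        by (simp add: w_def)
      moreover have "w * q = q - w"
        using q by (metis add_diff_cancel_left')
      ultimately show ?thesis
        by (simp add: scaleR_diff_right)
    qed
    \<comment> \<open>\<open>(1 - z)(1 + q) = 1 - q/2\<close>, whose inverse is \<open>1 + v\<close>\<close>
    have "z + z * (q + v + q * v) = q + v + q * v"
    proof -
      have qv: "q + q * v = 2 *\<^sub>R v"
        using arg_cong[OF v, of "\<lambda>t. 2 *\<^sub>R t"] by (simp add: scaleR_add_right)
      have "z * (q * v) = (3 / 2) *\<^sub>R (q * v) - z * v"
        by (simp add: zq left_diff_distrib flip: mult.assoc)
      then have "z + z * (q + v + q * v) = (3 / 2) *\<^sub>R (q + q * v)"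
        by (simp add: zq distrib_left scaleR_add_right)
      also have "\<dots> = v + 2 *\<^sub>R v"
        using scaleR_add_left[of 1 2 v] by (simp add: qv)
      also have "\<dots> = q + v + q * v"
        by (simp add: algebra_simps flip: qv)
      finally show ?thesis .
    qed
    then show ?case by metis
  qed
qed

text \<open>The conclusions make \<open>e\<close> idempotent, as
  \<open>e * e = e * x * u = x * u = e\<close>; it is the projection onto the right ideal generated
  by \<open>x\<close>.\<close>

lemma self_adjoint_range_projection:
  fixes x y :: "'a::cstar_algebra"
  assumes xyx: "x = x * y * x"
  obtains e u where "e\<^sup>\<star> = e" "e * x = x" "e = x * u"
proof -
  define p where "p = x * y"
  define z where "z = p\<^sup>\<star> - p"
  have pp: "p * p = p"
    using xyx by (metis p_def mult.assoc)
  then have ss: "p\<^sup>\<star> * p\<^sup>\<star> = p\<^sup>\<star>"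
    by (metis star_mult)
  have skew: "z\<^sup>\<star> = - z"
    by (simp add: z_def star_diff star_star)
  then obtain q where q: "q = z + z * q"
    using skew_adjoint_quasi_inverse_exists by blast
  have sz: "q\<^sup>\<star> * z = - z - q\<^sup>\<star>"
    using arg_cong[OF q, of star] by (simp add: star_add star_mult skew eq_diff_eq add.commute)
  have zp: "z * p = p\<^sup>\<star> * p - p"
    by (simp add: z_def left_diff_distrib pp)
  \<comment> \<open>Formally \<open>(1 + z) p = p\<^sup>\<star> p\<close>, and
    \<open>1 + q\<^sup>\<star>\<close> is a left inverse of \<open>1 + z\<close>.\<close>
  have 1: "p\<^sup>\<star> * p + q\<^sup>\<star> * (p\<^sup>\<star> * p) = p"
  proof -
    have "q\<^sup>\<star> * (z * p) = - (z * p) - q\<^sup>\<star> * p"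
      by (simp add: sz left_diff_distrib flip: mult.assoc)
    then show ?thesis
      by (simp add: zp algebra_simps)
  qed
  have 2: "p\<^sup>\<star> * p + p\<^sup>\<star> * p * q = p\<^sup>\<star>"
    using arg_cong[OF 1, of star] by (simp add: star_add star_mult star_star)
  define e where "e = p + p * q"
  \<comment> \<open>Substituting 1 and then 2, \<open>p (1 + q) = (1 + q\<^sup>\<star>)
    p\<^sup>\<star> p (1 + q) = (1 + q\<^sup>\<star>) p\<^sup>\<star>\<close>, the adjoint of
    \<open>e\<close>.\<close>
  have "e = p\<^sup>\<star> + q\<^sup>\<star> * p\<^sup>\<star>"
  proof -
    have "e = (p\<^sup>\<star> * p + q\<^sup>\<star> * (p\<^sup>\<star> * p)) + (p\<^sup>\<star> * p + q\<^sup>\<star> * (p\<^sup>\<star> * p)) * q"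
      unfolding 1 e_def ..
    also have "\<dots> = (p\<^sup>\<star> * p + p\<^sup>\<star> * p * q) + q\<^sup>\<star> * (p\<^sup>\<star> * p + p\<^sup>\<star> * p * q)"
      by (simp add: algebra_simps)
    finally show ?thesis unfolding 2 .
  qed
  then have "e\<^sup>\<star> = e" "e * p = p"
    using 1 by (simp_all add: e_def star_add star_mult star_star distrib_right mult.assoc)
  moreover have "p * x = x"
    using xyx by (simp add: p_def)
  ultimately have "e * x = x"
    by (metis mult.assoc)
  moreover have "e = x * (y + y * q)"
    by (simp add: e_def p_def distrib_left mult.assoc)
  ultimately show thesis
    using that \<open>e\<^sup>\<star> = e\<close> by blast
qed

lemma is_MP_inverse_sym: "is_MP_inverse x y \<longleftrightarrow> is_MP_inverse y x"
  by (auto simp: is_MP_inverse_def)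

text \<open>\<open>x * y\<close> and \<open>x * z\<close> are self-adjoint projections with the same
  range, hence equal; likewise \<open>y * x\<close> and \<open>z * x\<close>. Then
  \<open>y = y * x * y = z * x * z = z\<close>.\<close>

lemma is_MP_inverse_unique:
  assumes y: "is_MP_inverse x y" and z: "is_MP_inverse x z"
  shows "y = z"
proof -
  have "x * y = x * z"
  proof -
    have "x * y = (x * z) * (x * y)"
      using z by (simp add: is_MP_inverse_def flip: mult.assoc)
    also have "\<dots> = (x * y * (x * z))\<^sup>\<star>"
      using y z by (simp add: is_MP_inverse_def star_mult[of "x * y" "x * z"])
    also have "x * y * (x * z) = x * z"
      using y by (simp add: is_MP_inverse_def flip: mult.assoc)
    finally show ?thesis
      using z by (simp add: is_MP_inverse_def)
  qed
  moreover have "y * x = z * x"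
  proof -
    have "y * x = (y * x) * (z * x)"
      using z by (simp add: is_MP_inverse_def mult.assoc)
    also have "\<dots> = (z * x * (y * x))\<^sup>\<star>"
      using y z by (simp add: is_MP_inverse_def star_mult[of "z * x" "y * x"])
    also have "z * x * (y * x) = z * x"
      using y by (simp add: is_MP_inverse_def mult.assoc)
    finally show ?thesis
      using z by (simp add: is_MP_inverse_def)
  qed
  ultimately show ?thesis
    using y z unfolding is_MP_inverse_def by (metis mult.assoc)
qed

text \<open>Let \<open>e\<close> and \<open>f\<close> be the projections for \<open>x\<close> and
  \<open>x\<^sup>\<star>\<close>. Compressing any inner inverse \<open>y\<close> to
  \<open>f * y * e\<close> makes its products with \<open>x\<close> equal to \<open>e\<close> and
  \<open>f\<close>.\<close>

lemma regular_imp_is_MP_inverse: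
  fixes x :: "'a::cstar_algebra"
  assumes "regular x"
  shows "\<exists>y. is_MP_inverse x y"
proof -
  obtain y where y: "x = x * y * x"
    using assms by (auto simp: regular_def)
  obtain e u where e: "e\<^sup>\<star> = e" "e * x = x" "e = x * u"
    using self_adjoint_range_projection[OF y] .
  have "x\<^sup>\<star> = x\<^sup>\<star> * y\<^sup>\<star> * x\<^sup>\<star>"
    using arg_cong[OF y, of star] by (simp add: star_mult mult.assoc)
  then obtain f v where f: "f\<^sup>\<star> = f" "f * x\<^sup>\<star> = x\<^sup>\<star>" "f = x\<^sup>\<star> * v"
    by (rule self_adjoint_range_projection)
  have xf: "x * f = x"
    using f(1,2) by (metis star_mult star_star)
  have fx: "f = v\<^sup>\<star> * x"
    using f(1,3) by (metis star_mult star_star)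
  have "x * (f * y * e) = e"
    using y by (metis xf e(3) mult.assoc)
  moreover have "f * y * e * x = f"
    using y by (metis fx e(2) mult.assoc)
  moreover have "f * f = f"
    using xf fx by (metis mult.assoc)
  ultimately have "is_MP_inverse x (f * y * e)"
    using e(1,2) f(1) by (simp add: is_MP_inverse_def flip: mult.assoc)
  then show ?thesis ..
qed

lemma is_MP_inverse_MP_inverse: "regular x \<Longrightarrow> is_MP_inverse x (x\<^sup>\<dagger>)"
  unfolding MP_inverse_def
  using regular_imp_is_MP_inverse is_MP_inverse_unique by (metis theI)

text \<open>By symmetry \<open>x\<close> is the Moore-Penrose inverse of
  \<open>x\<^sup>\<dagger>\<close>, so uniqueness recovers it.\<close>

lemma MP_inverse_inject:
  assumes "regular x" "regular y" "x\<^sup>\<dagger> = y\<^sup>\<dagger>"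
  shows "x = y"
  using assms is_MP_inverse_MP_inverse is_MP_inverse_sym is_MP_inverse_unique by metis

theorem theorem2p6:
  fixes n :: nat and a :: "nat \<Rightarrow> 'a::cstar_algebra"
  assumes "\<And>i. i \<in> {1..n} \<Longrightarrow> regular (a i)"
    and "\<And>i j. i \<in> {1..n} \<Longrightarrow> j \<in> {1..n} \<Longrightarrow> i \<noteq> j \<Longrightarrow>
           regular (a i * a j) \<and> regular (a j * a i) \<and>
           regular ((a i)\<^sup>\<star> * a j) \<and> regular (a j * (a i)\<^sup>\<star>)"
    and "\<And>i j. i \<in> {1..n} \<Longrightarrow> j \<in> {1..n} \<Longrightarrow> i \<noteq> j \<Longrightarrow>
           (a i * a j)\<^sup>\<dagger> = (a j * a i)\<^sup>\<dagger> \<and>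
           ((a i)\<^sup>\<star> * a j)\<^sup>\<dagger> = (a j * (a i)\<^sup>\<star>)\<^sup>\<dagger>"
  shows "doubly_commuting n a \<and> (\<forall>i\<in>{1..n}. regular (a i))"
proof -
  \<comment> \<open>The second equation comes from the hypotheses with \<open>i\<close> and
    \<open>j\<close> exchanged.\<close>
  have "a i * a j = a j * a i" "a i * (a j)\<^sup>\<star> = (a j)\<^sup>\<star> * a i"
    if "i \<in> {1..n}" "j \<in> {1..n}" "i \<noteq> j" for i j
    using that assms(2,3)[of i j] assms(2,3)[of j i] by (metis MP_inverse_inject)+
  then show ?thesis
    using assms(1) by (simp add: doubly_commuting_def)
qed

end
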